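(* Let $f:2^N\to\mathbb{R}_+$ be a non-negative submodular function with multilinear extension $F$, let $P_{\mathcal{I}}$ be a convex relaxation of $\mathcal{I}\subseteq 2^N$, let $\pi$ be a monotone and strict $(b,c)$-balanced contention resolution scheme for $P_{\mathcal{I}}$, let $\mathbf{x}\in bP_{\mathcal{I}}$, and let $I=\pi_{\mathbf{x}}(R(\mathbf{x}))$. Then $\mathbb{E}[f(I)]\ge c\,F(\mathbf{x})$.
   Context: $R(\mathbf{x})$ is a random subset of $N$ containing each $i$ independently with probability $x_i$; $F(\mathbf{x})=\mathbb{E}[f(R(\mathbf{x}))]$. A convex relaxation $P_{\mathcal{I}}\subseteq[0,1]^N$ is a convex set containing $\{\mathbf{1}_S:S\in\mathcal{I}\}$, and $bP_{\mathcal{I}}=\{b\mathbf{x}:\mathbf{x}\in P_{\mathcal{I}}\}$. A $(b,c)$-balanced contention resolution scheme $\pi$ for $P_{\mathcal{I}}$ is a procedure that for every $\mathbf{x}\in bP_{\mathcal{I}}$ and $A\subseteq N$ returns a random set $\pi_{\mathbf{x}}(A)\subseteq A\cap\{i:x_i>0\}$ with $\pi_{\mathbf{x}}(A)\in\mathcal{I}$ with probability 1, such that $\Pr[i\in\pi_{\mathbf{x}}(R(\mathbf{x}))\mid i\in R(\mathbf{x})]\ge c$ for all $i$ with $x_i>0$. It is strict if this holds with equality, $\Pr[i\in\pi_{\mathbf{x}}(R(\mathbf{x}))\mid i\in R(\mathbf{x})]=c$. It is monotone if $\Pr[i\in\pi_{\mathbf{x}}(A_1)]\ge\Pr[i\in\pi_{\mathbf{x}}(A_2)]$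 whenever $i\in A_1\subseteq A_2$. *)

theory Defs
  imports "HOL-Probability.Probability"
begin

text \<open>
  The finite ground set N is the index type \<open>'n\<close>, so subsets of N have type \<open>'n set\<close> and points of
  \<open>[0,1]\<^sup>N\<close> are vectors in \<open>real ^ 'n\<close>.
\<close>

definition submodular :: "('n set \<Rightarrow> real) \<Rightarrow> bool" where
  "submodular f \<longleftrightarrow> (\<forall>A B. f (A \<union> B) + f (A \<inter> B) \<le> f A + f B)"

definition indicator_vec :: "'n set \<Rightarrow> real ^ 'n" where
  "indicator_vec S = (\<chi> i. if i \<in> S then 1 else 0)"

definition convex_relaxation :: "'n::finite set set \<Rightarrow> (real ^ 'n) set \<Rightarrow> bool" where
  "convex_relaxation \<I> P \<longleftrightarrow>
     convex P \<and> (\<forall>x\<in>P. \<forall>i. x $ i \<in> {0..1}) \<and> indicator_vec ` \<I> \<subseteq> P"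

definition scaled :: "real \<Rightarrow> (real ^ 'n) set \<Rightarrow> (real ^ 'n) set" where
  "scaled b P = (\<lambda>x. b *\<^sub>R x) ` P"

definition random_subset :: "real ^ 'n \<Rightarrow> 'n::finite set pmf" where
  "random_subset x =
     map_pmf (\<lambda>\<omega>. {i. \<omega> i}) (Pi_pmf UNIV False (\<lambda>i. bernoulli_pmf (x $ i)))"

definition multilinear_ext :: "('n set \<Rightarrow> real) \<Rightarrow> real ^ 'n::finite \<Rightarrow> real" where
  "multilinear_ext f x = measure_pmf.expectation (random_subset x) f"

text \<open>
  A randomized procedure \<open>\<pi>\<close> is given by the distribution \<open>\<pi> x A\<close> of its output for every \<open>x\<close> and \<open>A\<close>.
  Its internal randomness is independent of \<open>R(x)\<close>, so the pair \<open>(R(x), \<pi>\<^sub>x(R(x)))\<close> is distributed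
  as follows.
\<close>

type_synonym 'n scheme = "real ^ 'n \<Rightarrow> 'n set \<Rightarrow> 'n set pmf"

definition joint_selection :: "'n::finite scheme \<Rightarrow> real ^ 'n \<Rightarrow> ('n set \<times> 'n set) pmf" where
  "joint_selection \<pi> x = do { R \<leftarrow> random_subset x; S \<leftarrow> \<pi> x R; return_pmf (R, S) }"

definition selection :: "'n::finite scheme \<Rightarrow> real ^ 'n \<Rightarrow> 'n set pmf" where
  "selection \<pi> x = map_pmf snd (joint_selection \<pi> x)"

text \<open>\<open>Pr[i \<in> \<pi>\<^sub>x(R(x)) | i \<in> R(x)]\<close>\<close>

definition selection_prob :: "'n::finite scheme \<Rightarrow> real ^ 'n \<Rightarrow> 'n \<Rightarrow> real" where
  "selection_prob \<pi> x i = \<P>(\<omega> in joint_selection \<pi> x. i \<in> snd \<omega> \<bar> i \<in> fst \<omega>)"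

text \<open>
  As usual, the parameters \<open>b\<close> and \<open>c\<close> of a contention resolution scheme lie in \<open>[0,1]\<close>. The bound
  on \<open>c\<close> does not follow from the other conditions when 0 is the only point of \<open>scaled b P\<close>.
\<close>

definition balanced_crs ::
  "real \<Rightarrow> real \<Rightarrow> 'n::finite set set \<Rightarrow> (real ^ 'n) set \<Rightarrow> 'n scheme \<Rightarrow> bool" where
  "balanced_crs b c \<I> P \<pi> \<longleftrightarrow>
     b \<in> {0..1} \<and> c \<in> {0..1} \<and>
     (\<forall>x\<in>scaled b P.
        (\<forall>A. \<forall>S\<in>set_pmf (\<pi> x A). S \<subseteq> A \<inter> {i. x $ i > 0} \<and> S \<in> \<I>) \<and>
        (\<forall>i. x $ i > 0 \<longrightarrow> selection_prob \<pi> x i \<ge> c))"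

definition strict_balanced_crs ::
  "real \<Rightarrow> real \<Rightarrow> 'n::finite set set \<Rightarrow> (real ^ 'n) set \<Rightarrow> 'n scheme \<Rightarrow> bool" where
  "strict_balanced_crs b c \<I> P \<pi> \<longleftrightarrow>
     balanced_crs b c \<I> P \<pi> \<and>
     (\<forall>x\<in>scaled b P. \<forall>i. x $ i > 0 \<longrightarrow> selection_prob \<pi> x i = c)"

definition monotone_crs :: "real \<Rightarrow> (real ^ 'n) set \<Rightarrow> 'n::finite scheme \<Rightarrow> bool" where
  "monotone_crs b P \<pi> \<longleftrightarrow>
     (\<forall>x\<in>scaled b P. \<forall>i A1 A2. i \<in> A1 \<and> A1 \<subseteq> A2 \<longrightarrow>
        measure_pmf.prob (\<pi> x A1) {S. i \<in> S} \<ge> measure_pmf.prob (\<pi> x A2) {S. i \<in> S})"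

end

theory Submission
  imports Defs
begin

text \<open>
  Build \<open>I \<inter> J\<close> and \<open>R \<inter> J\<close> up one element \<open>i\<close> at a time. By submodularity, the gain of adding
  \<open>i \<in> I\<close> to \<open>I \<inter> J\<close> is at least its marginal value \<open>v(R)\<close> with respect to the larger set \<open>R \<inter> J\<close>.
  Conditioned on \<open>i \<in> R\<close>, both \<open>v(R)\<close> and the probability of selecting \<open>i\<close> given \<open>R\<close> are decreasing
  in \<open>R \ {i}\<close>, so Harris' inequality bounds the expected gain below by \<open>c\<close> times
  the expected gain of adding \<open>i\<close> to \<open>R \<inter> J\<close>; strictness makes the factor exactly \<open>c\<close>, which matters
  because \<open>v\<close> may be negative. Summing up gives \<open>E[f(I)] - f({}) \<ge> c (F(x) - f({}))\<close>.
\<close>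

lemma integrable_pmf_finite_type [simp]:
  fixes h :: "'a::finite \<Rightarrow> real"
  shows "integrable (measure_pmf M) h"
  by (rule integrable_measure_pmf_finite) simp

lemma expectation_bind_pmf_finite:
  fixes h :: "'b::finite \<Rightarrow> real" and M :: "'a::finite pmf"
  shows "measure_pmf.expectation (bind_pmf M K) h =
    measure_pmf.expectation M (\<lambda>a. measure_pmf.expectation (K a) h)"
  by (simp add: pmf_expectation_bind[of UNIV] integral_measure_pmf[of UNIV M])

text \<open>Letting the ground set \<open>S\<close> vary permits induction on \<open>S\<close>, and
  \<open>S = - {i}\<close> gives the law of the random set without \<open>i\<close> once the coin of
  \<open>i\<close> is fixed.\<close>

definition random_subset_of :: "('n \<Rightarrow> real) \<Rightarrow> 'n set \<Rightarrow> 'n::finite set pmf" where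
  "random_subset_of p S = map_pmf Collect (Pi_pmf S False (\<lambda>i. bernoulli_pmf (p i)))"

lemma random_subset_eq: "random_subset x = random_subset_of (($) x) UNIV"
  by (simp add: random_subset_def random_subset_of_def)

lemma set_random_subset_of: "A \<in> set_pmf (random_subset_of p S) \<Longrightarrow> A \<subseteq> S"
  using set_Pi_pmf_subset[of S False "\<lambda>i. bernoulli_pmf (p i)"]
  by (auto simp: random_subset_of_def)

lemma random_subset_of_insert:
  assumes "a \<notin> S"
  shows "random_subset_of p (insert a S) =
    bernoulli_pmf (p a) \<bind>
      (\<lambda>y. map_pmf (\<lambda>A. if y then insert a A else A) (random_subset_of p S))"
proof -
  \<comment> \<open>Outside \<open>S\<close> the product takes the default \<open>False\<close>, so
    the update \<open>a := False\<close> changes nothing and a failed coin leaves the set as it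
    was.\<close>
  have supp: "\<not> f a" if "f \<in> set_pmf (Pi_pmf S False (\<lambda>i. bernoulli_pmf (p i)))" for f
    using subsetD[OF set_Pi_pmf_subset that] assms by simp
  have *: "map_pmf (\<lambda>f. Collect (f(a := y))) (Pi_pmf S False (\<lambda>i. bernoulli_pmf (p i))) =
      map_pmf (\<lambda>f. if y then insert a (Collect f) else Collect f)
        (Pi_pmf S False (\<lambda>i. bernoulli_pmf (p i)))" for y
    by (intro map_pmf_cong refl) (auto split: if_splits dest: supp)
  show ?thesis
    using assms unfolding random_subset_of_def
    by (simp add: Pi_pmf_insert' map_bind_pmf map_pmf_comp * flip: map_pmf_def)
qed

lemma expectation_random_subset_of_insert:
  fixes h :: "'n::finite set \<Rightarrow> real"
  assumes "a \<notin> S" "p a \<in> {0..1}"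
  shows "measure_pmf.expectation (random_subset_of p (insert a S)) h =
    p a * measure_pmf.expectation (random_subset_of p S) (\<lambda>A. h (insert a A)) +
    (1 - p a) * measure_pmf.expectation (random_subset_of p S) h"
  using assms by (simp add: random_subset_of_insert expectation_bind_pmf_finite)

text \<open>Induction on \<open>S\<close>, conditioning on the coin of \<open>a\<close>. Both
  conditional functions are again antimonotone, so the induction hypothesis handles each branch;
  what remains is the correlation inequality for a single coin.\<close>

theorem Harris_inequality:
  fixes u v :: "'n::finite set \<Rightarrow> real"
  assumes "\<And>i. i \<in> S \<Longrightarrow> p i \<in> {0..1}" "antimono u" "antimono v"
  shows "measure_pmf.expectation (random_subset_of p S) u *
      measure_pmf.expectation (random_subset_of p S) v
    \<le> measure_pmf.expectation (random_subset_of p S) (\<lambda>A. u A * v A)"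
  using finite[of S] assms
proof (induction S arbitrary: u v rule: finite_induct)
  case empty
  show ?case by (simp add: random_subset_of_def)
next
  case (insert a S)
  define E :: "('n set \<Rightarrow> real) \<Rightarrow> real" where "E = measure_pmf.expectation (random_subset_of p S)"
  define q where "q = p a"
  define u1 v1 where "u1 = (\<lambda>A. u (insert a A))" and "v1 = (\<lambda>A. v (insert a A))"
  have q: "0 \<le> q" "q \<le> 1" using insert.prems(1)[of a] by (auto simp: q_def)
  have anti1: "antimono u1" "antimono v1"
    unfolding u1_def v1_def
    by (auto intro!: antimonoI antimonoD[OF insert.prems(2)] antimonoD[OF insert.prems(3)])
  have IH: "E u * E v \<le> E (\<lambda>A. u A * v A)" "E u1 * E v1 \<le> E (\<lambda>A. u1 A * v1 A)"
    unfolding E_def using insert.prems anti1 by (intro insert.IH; simp)+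
  have le: "E u1 \<le> E u" "E v1 \<le> E v"
    unfolding E_def u1_def v1_def
    by (auto intro!: integral_mono antimonoD[OF insert.prems(2)] antimonoD[OF insert.prems(3)])
  \<comment> \<open>This product is the covariance, over the coin of \<open>a\<close>, of the two
    conditional means. Both means drop when \<open>a\<close> is added, so the factors have the same
    sign.\<close>
  have "0 \<le> q * (1 - q) * ((E u - E u1) * (E v - E v1))"
    using q le by (intro mult_nonneg_nonneg) auto
  hence "(q * E u1 + (1 - q) * E u) * (q * E v1 + (1 - q) * E v)
      \<le> q * (E u1 * E v1) + (1 - q) * (E u * E v)"
    by (simp add: algebra_simps)
  also have "\<dots> \<le> q * E (\<lambda>A. u1 A * v1 A) + (1 - q) * E (\<lambda>A. u A * v A)"
    using q IH by (intro add_mono mult_left_mono) auto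
  finally show ?case
    using insert.hyps insert.prems(1)[of a]
    by (simp add: expectation_random_subset_of_insert E_def q_def u1_def v1_def)
qed

text \<open>Conditioning on \<open>i \<in> R\<close>, an event of probability \<open>x $ i\<close>,
  leaves the other coins untouched.\<close>

lemma expectation_random_subset_indicator:
  fixes h :: "'n::finite set \<Rightarrow> real"
  assumes "x $ i \<in> {0..1}"
  shows "measure_pmf.expectation (random_subset x) (\<lambda>R. of_bool (i \<in> R) * h R) =
    x $ i * measure_pmf.expectation (random_subset_of (($) x) (- {i})) (\<lambda>A. h (insert i A))"
proof -
  \<comment> \<open>The branch where the coin of \<open>i\<close> fails contributes nothing, since
    sets drawn from \<open>- {i}\<close> never contain \<open>i\<close>.\<close>
  have "measure_pmf.expectation (random_subset_of (($) x) (- {i})) (\<lambda>A. of_bool (i \<in> A) * h A)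
      = measure_pmf.expectation (random_subset_of (($) x) (- {i})) (\<lambda>_. 0)"
    by (intro integral_cong_AE) (auto simp: AE_measure_pmf_iff dest: set_random_subset_of)
  moreover have "UNIV = insert i (- {i})" by auto
  ultimately show ?thesis
    using expectation_random_subset_of_insert[of i "- {i}" "($) x" "\<lambda>R. of_bool (i \<in> R) * h R"] assms
    by (simp add: random_subset_eq)
qed

lemma submodular_marginal_antimono:
  assumes "submodular f" "A \<subseteq> B" "i \<notin> B"
  shows "f (insert i B) - f B \<le> f (insert i A) - f A"
proof -
  have "insert i A \<union> B = insert i B" "insert i A \<inter> B = A" using assms(2,3) by auto
  with assms(1) have "f (insert i B) + f A \<le> f (insert i A) + f B"
    unfolding submodular_def by metis
  thus ?thesis by simp
qed

lemma expectation_joint_selection: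
  fixes h :: "'n::finite set \<times> 'n set \<Rightarrow> real"
  shows "measure_pmf.expectation (joint_selection \<pi> x) h =
    measure_pmf.expectation (random_subset x)
      (\<lambda>R. measure_pmf.expectation (\<pi> x R) (\<lambda>S. h (R, S)))"
  by (simp add: joint_selection_def expectation_bind_pmf_finite)

lemma expectation_of_bool:
  "measure_pmf.expectation M (\<lambda>S. of_bool (Q S)) = measure_pmf.prob M {S. Q S}"
proof -
  have "(\<lambda>S. of_bool (Q S)) = (indicator {S. Q S} :: _ \<Rightarrow> real)"
    by (simp add: fun_eq_iff indicator_def)
  thus ?thesis by simp
qed

text \<open>The output lies in the input set, so selecting \<open>i\<close> already implies the
  conditioning event \<open>i \<in> R\<close>, whose probability is \<open>x $ i\<close>.\<close>

lemma joint_selection_prob: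
  assumes "x $ i \<in> {0..1}" "\<And>A S. S \<in> set_pmf (\<pi> x A) \<Longrightarrow> S \<subseteq> A"
  shows "measure_pmf.expectation (joint_selection \<pi> x) (\<lambda>\<omega>. of_bool (i \<in> snd \<omega>)) =
    x $ i * selection_prob \<pi> x i"
proof -
  let ?J = "joint_selection \<pi> x"
  have "measure_pmf.prob ?J {\<omega>. i \<in> fst \<omega>} = x $ i"
    using expectation_random_subset_indicator[OF assms(1), of "\<lambda>_. 1"]
    by (simp add: expectation_joint_selection flip: expectation_of_bool)
  moreover have "measure_pmf.prob ?J {\<omega>. i \<in> snd \<omega>} = measure_pmf.prob ?J {\<omega>. i \<in> snd \<omega> \<and> i \<in> fst \<omega>}"
    using assms(2) by (intro measure_pmf.finite_measure_eq_AE)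
      (auto simp: AE_measure_pmf_iff joint_selection_def)
  \<comment> \<open>Covers \<open>x $ i = 0\<close>: there the conditional probability is a division
    by zero, and this bound forces the left-hand side to vanish as well.\<close>
  moreover have "measure_pmf.prob ?J {\<omega>. i \<in> snd \<omega> \<and> i \<in> fst \<omega>} \<le> measure_pmf.prob ?J {\<omega>. i \<in> fst \<omega>}"
    by (intro measure_pmf.finite_measure_mono) auto
  ultimately show ?thesis
    by (auto simp: expectation_of_bool selection_prob_def cond_prob_def
        intro!: antisym measure_nonneg)
qed

lemma expectation_selected_antimono:
  fixes \<pi> :: "'n::finite scheme" and v :: "'n set \<Rightarrow> real"
  assumes x: "\<And>j. x $ j \<in> {0..1}"
    and sub: "\<And>A S. S \<in> set_pmf (\<pi> x A) \<Longrightarrow> S \<subseteq> A"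
    and mono: "\<And>A B. i \<in> A \<Longrightarrow> A \<subseteq> B \<Longrightarrow>
      measure_pmf.prob (\<pi> x B) {S. i \<in> S} \<le> measure_pmf.prob (\<pi> x A) {S. i \<in> S}"
    and strict: "x $ i > 0 \<Longrightarrow> selection_prob \<pi> x i = c"
    and v: "antimono v" "\<And>A. v (insert i A) = v A"
  shows "c * measure_pmf.expectation (random_subset x) (\<lambda>R. of_bool (i \<in> R) * v R)
    \<le> measure_pmf.expectation (joint_selection \<pi> x) (\<lambda>\<omega>. of_bool (i \<in> snd \<omega>) * v (fst \<omega>))"
proof -
  define u where "u A = measure_pmf.prob (\<pi> x A) {S. i \<in> S}" for A
  define E :: "('n set \<Rightarrow> real) \<Rightarrow> real" where "E = measure_pmf.expectation (random_subset_of (($) x) (- {i}))"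
  have "u A = 0" if "i \<notin> A" for A
    using sub[of _ A] that by (auto simp: u_def measure_pmf_zero_iff)
  hence u: "u A = of_bool (i \<in> A) * u A" for A by (cases "i \<in> A") simp_all
  have joint: "measure_pmf.expectation (joint_selection \<pi> x) (\<lambda>\<omega>. of_bool (i \<in> snd \<omega>) * w (fst \<omega>))
      = x $ i * E (\<lambda>A. u (insert i A) * w (insert i A))" for w
  proof -
    have "measure_pmf.expectation (joint_selection \<pi> x) (\<lambda>\<omega>. of_bool (i \<in> snd \<omega>) * w (fst \<omega>))
        = measure_pmf.expectation (random_subset x) (\<lambda>R. u R * w R)"
      by (simp add: expectation_joint_selection expectation_of_bool u_def)
    also have "\<dots> = measure_pmf.expectation (random_subset x) (\<lambda>R. of_bool (i \<in> R) * (u R * w R))"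
      by (subst u) (simp add: mult.assoc)
    finally show ?thesis
      by (simp only: expectation_random_subset_indicator[OF x] E_def)
  qed
  \<comment> \<open>With weight 1, \<open>joint\<close> computes the probability of selecting
    \<open>i\<close>, which is \<open>c * x $ i\<close> by strictness; for \<open>x $ i = 0\<close>
    both sides are 0.\<close>
  have "c * (x $ i * E v) = x $ i * E (\<lambda>A. u (insert i A)) * E v"
    using joint[of "\<lambda>_. 1"] joint_selection_prob[of x i \<pi>, OF x sub] strict x[of i]
    by (cases "x $ i = 0") auto
  also have "\<dots> \<le> x $ i * E (\<lambda>A. u (insert i A) * v A)"
  proof -
    have "antimono (\<lambda>A. u (insert i A))"
      unfolding u_def by (auto intro!: antimonoI mono)
    with x[of i] x v(1) show ?thesis
      unfolding E_def mult.assoc by (intro mult_left_mono Harris_inequality) auto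
  qed
  finally show ?thesis
    by (simp add: expectation_random_subset_indicator[OF x] joint v(2) E_def)
qed

theorem theorem4p1:
  fixes f :: "'n::finite set \<Rightarrow> real"
    and \<I> :: "'n set set"
    and P :: "(real ^ 'n) set"
    and \<pi> :: "'n scheme"
    and b c :: real
    and x :: "real ^ 'n"
  assumes "\<And>S. f S \<ge> 0"
    and "submodular f"
    and "convex_relaxation \<I> P"
    and "strict_balanced_crs b c \<I> P \<pi>"
    and "monotone_crs b P \<pi>"
    and "x \<in> scaled b P"
  shows "measure_pmf.expectation (selection \<pi> x) f \<ge> c * multilinear_ext f x"
proof -
  have b: "b \<in> {0..1}" and c: "c \<in> {0..1}"
    and sub: "\<And>A S. S \<in> set_pmf (\<pi> x A) \<Longrightarrow> S \<subseteq> A"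
    and strict: "\<And>i. x $ i > 0 \<Longrightarrow> selection_prob \<pi> x i = c"
    using assms(4,6) unfolding strict_balanced_crs_def balanced_crs_def by blast+
  obtain y where "y \<in> P" "x = b *\<^sub>R y" using assms(6) by (auto simp: scaled_def)
  hence x: "x $ i \<in> {0..1}" for i
    using assms(3) b by (auto simp: convex_relaxation_def intro!: mult_le_one)
  define EJ :: "('n set \<times> 'n set \<Rightarrow> real) \<Rightarrow> real" where "EJ = measure_pmf.expectation (joint_selection \<pi> x)"
  define ER :: "('n set \<Rightarrow> real) \<Rightarrow> real" where "ER = measure_pmf.expectation (random_subset x)"
  \<comment> \<open>Subtracting \<open>f {}\<close> on both sides makes the base case read 0 \<le> 0
    and leaves only marginal gains to compare.\<close>
  have "c * (ER (\<lambda>R. f (R \<inter> J)) - f {}) \<le> EJ (\<lambda>\<omega>. f (snd \<omega> \<inter> J)) - f {}" for J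
    using finite[of J]
  proof (induction J rule: finite_induct)
    case empty
    show ?case by (simp add: ER_def EJ_def)
  next
    case (insert i J)
    define v where "v R = f (insert i (R \<inter> J)) - f (R \<inter> J)" for R
    have split: "f (A \<inter> insert i J) = f (A \<inter> J) + of_bool (i \<in> A) * v A" for A
      by (auto simp: v_def)
    \<comment> \<open>Since \<open>i \<notin> J\<close>, the set \<open>R \<inter> J\<close> avoids
      \<open>i\<close> even when \<open>i \<in> R\<close>, so diminishing returns apply to all
      \<open>R\<close>.\<close>
    have v: "antimono v"
      unfolding v_def using insert.hyps(2)
      by (intro antimonoI submodular_marginal_antimono assms(2)) auto
    have v': "v (insert i A) = v A" for A using insert.hyps(2) by (simp add: v_def)
    have "c * ER (\<lambda>R. of_bool (i \<in> R) * v R) \<le> EJ (\<lambda>\<omega>. of_bool (i \<in> snd \<omega>) * v (fst \<omega>))"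
      unfolding ER_def EJ_def using assms(5,6)
      by (intro expectation_selected_antimono x sub strict v v') (auto simp: monotone_crs_def)
    also have "\<dots> \<le> EJ (\<lambda>\<omega>. of_bool (i \<in> snd \<omega>) * v (snd \<omega>))"
      unfolding EJ_def using sub v
      by (intro integral_mono_AE)
        (auto simp: AE_measure_pmf_iff joint_selection_def antimono_def)
    finally have "c * ER (\<lambda>R. of_bool (i \<in> R) * v R) \<le> EJ (\<lambda>\<omega>. of_bool (i \<in> snd \<omega>) * v (snd \<omega>))" .
    with insert.IH show ?case by (simp add: split ER_def EJ_def algebra_simps)
  qed
  from this[of UNIV] have "c * (multilinear_ext f x - f {}) \<le> measure_pmf.expectation (selection \<pi> x) f - f {}"
    by (simp add: ER_def EJ_def multilinear_ext_def selection_def)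
  \<comment> \<open>Nonnegativity of \<open>f\<close> and \<open>c \<le> 1\<close> absorb the
    constant left over from the telescoped bound.\<close>
  moreover have "c * f {} \<le> f {}"
    using c assms(1)[of "{}"] by (auto intro: mult_left_le_one_le)
  ultimately show ?thesis by (simp add: algebra_simps)
qed

end
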